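(* Let $m<n$, $\mathbf{y}\in\mathbb{R}^m$, $\lambda>0$. Let $\mathbf{A}\in\mathbb{R}^{n\times n}$ be the matrix of a periodic two-dimensional convolution, let $\mathbf{M}\in\{0,1\}^{m\times n}$ be a masking matrix (its rows are a subset of the rows of the $n\times n$ identity matrix), and let $\mathbf{W}\in\mathbb{R}^{n\times d}$ ($d\ge n$) be a matrix whose columns are the elements of a frame of $\mathbb{R}^n$. Then, for any $\mu_1,\mu_2>0$ and any initialization, the sequence $(\mathbf{z}_k)$ generated by Algorithm FS-MD (described in the context) converges to a solution of $$\min_{\mathbf{z}\in\mathbb{R}^d}\ \frac12\|\mathbf{y}-\mathbf{M}\mathbf{A}\mathbf{W}\mathbf{z}\|_2^2+\lambda\|\mathbf{z}\|_1.$$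
   Context: $(\cdot)^*$ denotes transpose and $\mathbf{I}$ the identity. Elements of $\mathbb{R}^n$ are images on an $N_1\times N_2$ grid, $n=N_1N_2$, in lexicographic order. "Periodic convolution" means $(\mathbf{A}\mathbf{x})(r)=\sum_q h(r-q)\mathbf{x}(q)$ for some real kernel $h$, with pixel indices taken modulo $(N_1,N_2)$; equivalently $\mathbf{A}$ is block-circulant with circulant blocks and is diagonalized by the 2D discrete Fourier transform. The soft-threshold function is $\mathrm{soft}(\mathbf{v},\gamma)=\mathrm{sign}(\mathbf{v})\odot\max\{|\mathbf{v}|-\gamma,0\}$, with sign, max and absolute value applied componentwise and $\odot$ the componentwise product. Algorithm FS-MD (frame synthesis mask decoupling): choose $\mu_1,\mu_2>0$, $\mathbf{u}^{(1)}_0,\mathbf{d}^{(1)}_0\in\mathbb{R}^n$ and $\mathbf{u}^{(2)}_0,\mathbf{d}^{(2)}_0\in\mathbb{R}^d$ arbitrary. For $k=0,1,2,\dots$ (run without stopping) set $\boldsymbol{\zeta}^{(j)}=\mathbf{u}^{(j)}_k+\mathbf{d}^{(j)}_k$ ($j=1,2$) and $$\mathbf{z}_{k+1}=\Bigl(\mathbf{W}^*\mathbf{A}^*\mathbf{A}\mathbf{W}+\tfrac{\mu_2}{\mu_1}\mathbf{I}\Bigr)^{-1}\Bigl(\mathbf{W}^*\mathbf{A}^*\boldsymbol{\zeta}^{(1)}+\tfrac{\mu_2}{\mu_1}\boldsymbol{\zeta}^{(2)}\Bigr),$$ $$\mathbf{u}^{(1)}_{k+1}=(\mathbf{M}^*\mathbf{M}+\mu_1\mathbf{I})^{-1}\bigl(\mathbf{M}^*\mathbf{y}+\mu_1(\mathbf{A}\mathbf{W}\mathbf{z}_{k+1}-\mathbf{d}^{(1)}_k)\bigr),\qquad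 \mathbf{d}^{(1)}_{k+1}=\mathbf{d}^{(1)}_k-(\mathbf{A}\mathbf{W}\mathbf{z}_{k+1}-\mathbf{u}^{(1)}_{k+1}),$$ $$\mathbf{u}^{(2)}_{k+1}=\mathrm{soft}\bigl(\mathbf{z}_{k+1}-\mathbf{d}^{(2)}_k,\lambda/\mu_2\bigr),\qquad \mathbf{d}^{(2)}_{k+1}=\mathbf{d}^{(2)}_k-(\mathbf{z}_{k+1}-\mathbf{u}^{(2)}_{k+1}).$$ *)

theory Defs
  imports "HOL-Analysis.Analysis" "Berlekamp_Zassenhaus.Finite_Field"
begin

text \<open>
  Pixels are pairs of residues: \<open>'r mod_ring\<close> is the integers modulo \<open>CARD('r)\<close>, so subtraction of
  pixels (componentwise on pairs) is subtraction modulo \<open>(N1, N2) = (CARD('r), CARD('c))\<close>, and images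
  are indexed by pixels directly rather than by their lexicographic rank.
\<close>

type_synonym ('r, 'c) pixel = "'r mod_ring \<times> 'c mod_ring"

definition periodic_convolution ::
    "(real ^ ('r::finite, 'c::finite) pixel) ^ ('r, 'c) pixel \<Rightarrow> bool" where
  "periodic_convolution A \<longleftrightarrow>
     (\<exists>h :: ('r, 'c) pixel \<Rightarrow> real.
        \<forall>(x :: real ^ ('r, 'c) pixel) r. (A *v x) $ r = (\<Sum>q\<in>UNIV. h (r - q) * x $ q))"

text \<open>Injectivity makes the rows of a mask distinct: no row of the identity is selected twice.\<close>

definition masking_matrix :: "real ^ 'n::finite ^ 'm::finite \<Rightarrow> bool" where
  "masking_matrix M \<longleftrightarrow>
     rows M \<subseteq> rows (mat 1 :: real ^ 'n ^ 'n) \<and> inj (\<lambda>i. row i M)"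

definition is_frame :: "('i::finite \<Rightarrow> 'a::real_inner) \<Rightarrow> bool" where
  "is_frame w \<longleftrightarrow>
     (\<exists>a b. 0 < a \<and> a \<le> b \<and>
        (\<forall>x. a * (norm x)\<^sup>2 \<le> (\<Sum>i\<in>UNIV. (x \<bullet> w i)\<^sup>2) \<and>
             (\<Sum>i\<in>UNIV. (x \<bullet> w i)\<^sup>2) \<le> b * (norm x)\<^sup>2))"

definition soft :: "real ^ 'd::finite \<Rightarrow> real \<Rightarrow> real ^ 'd" where
  "soft v \<gamma> = (\<chi> i. sgn (v $ i) * max (\<bar>v $ i\<bar> - \<gamma>) 0)"

definition norm1 :: "real ^ 'd::finite \<Rightarrow> real" where
  "norm1 z = (\<Sum>i\<in>UNIV. \<bar>z $ i\<bar>)"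

definition synthesis_objective ::
    "real ^ 'n::finite ^ 'n \<Rightarrow> real ^ 'n ^ 'm::finite \<Rightarrow> real ^ 'd::finite ^ 'n \<Rightarrow>
     real ^ 'm \<Rightarrow> real \<Rightarrow> real ^ 'd \<Rightarrow> real" where
  "synthesis_objective A M W y reg z =
     1 / 2 * (norm (y - (M ** A ** W) *v z))\<^sup>2 + reg * norm1 z"

text \<open>
  Runs of the iteration. The initial values of \<open>u1\<close>, \<open>d1\<close>, \<open>u2\<close>, \<open>d2\<close> are unconstrained; \<open>z 0\<close> is a
  dummy, since the algorithm only produces \<open>z (Suc k)\<close>. Both inverted matrices are positive definite
  for positive \<open>\<mu>1\<close> and \<open>\<mu>2\<close>, so \<open>matrix_inv\<close> is the genuine inverse there.
\<close>

definition FS_MD ::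
    "real ^ 'n::finite ^ 'n \<Rightarrow> real ^ 'n ^ 'm::finite \<Rightarrow> real ^ 'd::finite ^ 'n \<Rightarrow>
     real ^ 'm \<Rightarrow> real \<Rightarrow> real \<Rightarrow> real \<Rightarrow>
     (nat \<Rightarrow> real ^ 'd) \<Rightarrow> (nat \<Rightarrow> real ^ 'n) \<Rightarrow> (nat \<Rightarrow> real ^ 'n) \<Rightarrow>
     (nat \<Rightarrow> real ^ 'd) \<Rightarrow> (nat \<Rightarrow> real ^ 'd) \<Rightarrow> bool" where
  "FS_MD A M W y reg \<mu>1 \<mu>2 z u1 d1 u2 d2 \<longleftrightarrow>
     (\<forall>k.
        z (Suc k) =
          matrix_inv (transpose W ** transpose A ** A ** W + (\<mu>2 / \<mu>1) *\<^sub>R mat 1) *v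
            ((transpose W ** transpose A) *v (u1 k + d1 k) + (\<mu>2 / \<mu>1) *\<^sub>R (u2 k + d2 k)) \<and>
        u1 (Suc k) =
          matrix_inv (transpose M ** M + \<mu>1 *\<^sub>R mat 1) *v
            (transpose M *v y + \<mu>1 *\<^sub>R ((A ** W) *v z (Suc k) - d1 k)) \<and>
        d1 (Suc k) = d1 k - ((A ** W) *v z (Suc k) - u1 (Suc k)) \<and>
        u2 (Suc k) = soft (z (Suc k) - d2 k) (reg / \<mu>2) \<and>
        d2 (Suc k) = d2 k - (z (Suc k) - u2 (Suc k)))"

end

theory Submission
  imports Defs
begin

text \<open>
  The iteration is ADMM for minimising \<open>f (G z)\<close>, where \<open>f\<close> is the sum of the quadratic misfit
  and the weighted \<open>l1\<close> norm on the product space and \<open>G z = (A W z, z)\<close>; the weights \<open>\<mu>1\<close>, \<open>\<mu>2\<close> are absorbed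
  by scaling the two components by their square roots. Let \<open>g k = G (z (k + 1))\<close>, which is the projection
  of \<open>u k + d k\<close> onto the range of \<open>G\<close>. For any saddle point \<open>(p, q)\<close>, the quantity
  \<open>|(u k - d k) - (p - q)|^2\<close> drops in each step by \<open>|u k - g k|^2 - 2 (u k - p) \<bullet> (d k - q)\<close>, and both
  terms are nonnegative because subgradients are monotone. Hence the iterates are bounded and
  \<open>u k - g k\<close> tends to zero, so every cluster point is a saddle point; using it as \<open>(p, q)\<close> gives
  convergence of the whole sequence.
\<close>

section \<open>Convergence of abstract ADMM\<close>

text \<open>These are the optimality conditions for minimising \<open>f\<close> over
  \<open>S\<close>, with multiplier \<open>q\<close>. The sign makes \<open>-q\<close> a subgradient
  of \<open>f\<close> at \<open>p\<close>, matching the dual iterates, for which \<open>-d\<close>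
  is a subgradient at \<open>u\<close>.\<close>

definition saddle_point :: "('a::real_inner \<Rightarrow> real) \<Rightarrow> 'a set \<Rightarrow> 'a \<Rightarrow> 'a \<Rightarrow> bool" where
  "saddle_point f S p q \<longleftrightarrow>
     p \<in> S \<and> (\<forall>s\<in>S. q \<bullet> s = 0) \<and> (\<forall>v. f p - q \<bullet> (v - p) \<le> f v)"

lemma saddle_point_minimum:
  assumes "subspace S" "saddle_point f S p q" "s \<in> S"
  shows "f p \<le> f s"
proof -
  have "s - p \<in> S"
    using assms by (auto simp: saddle_point_def intro: subspace_diff)
  then have "q \<bullet> (s - p) = 0"
    using assms by (auto simp: saddle_point_def)
  then show ?thesis
    using assms(2) unfolding saddle_point_def by (metis diff_zero)
qed

text \<open>The hypothesis turns all cross terms with \<open>g\<close> into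
  \<open>g \<bullet> g\<close>, so both sides reduce to the sum of the squared norms of
  \<open>U\<close> and \<open>D\<close>.\<close>

lemma admm_step_identity:
  fixes U D g :: "'a::real_inner"
  assumes "(U + D - g) \<bullet> g = 0"
  shows "(norm (g - D))\<^sup>2 + (norm (U - g))\<^sup>2 = (norm (U - D))\<^sup>2 + 2 * (U \<bullet> D)"
proof -
  have "U \<bullet> g + D \<bullet> g = g \<bullet> g"
    using assms by (simp add: inner_diff_left inner_add_left)
  then show ?thesis
    by (simp add: power2_norm_eq_inner inner_diff_left inner_diff_right inner_commute)
qed

lemma admm_descent:
  fixes f :: "'a::real_inner \<Rightarrow> real"
  assumes S: "subspace S"
    and sp: "saddle_point f S p q"
    and g: "g \<in> S" "\<And>s. s \<in> S \<Longrightarrow> (u + d - g) \<bullet> s = 0"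
    and sub: "\<And>v. f u - d \<bullet> (v - u) \<le> f v"
  shows "(norm ((g - d) - (p - q)))\<^sup>2 + (norm (u - g))\<^sup>2 \<le> (norm ((u - d) - (p - q)))\<^sup>2"
    and "(norm (u - p))\<^sup>2 + (norm (d - q))\<^sup>2 \<le> (norm ((u - d) - (p - q)))\<^sup>2"
proof -
  have p: "p \<in> S" "\<And>s. s \<in> S \<Longrightarrow> q \<bullet> s = 0" and subp: "\<And>v. f p - q \<bullet> (v - p) \<le> f v"
    using sp by (auto simp: saddle_point_def)
  \<comment> \<open>Each subgradient inequality is tested at the base point of the other. Adding the
    two cancels the values of \<open>f\<close>; the product is nonpositive because \<open>-d\<close>
    and \<open>-q\<close> are the subgradients.\<close>
  have "f u - d \<bullet> (p - u) \<le> f p" "f p - q \<bullet> (u - p) \<le> f u"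
    using sub subp by blast+
  then have mono: "(u - p) \<bullet> (d - q) \<le> 0"
    by (simp add: algebra_simps inner_commute)
  have gp: "g - p \<in> S"
    using S g(1) p(1) by (rule subspace_diff)
  \<comment> \<open>Orthogonality survives the shift by the saddle point: \<open>g - p\<close> stays
    in \<open>S\<close>, and \<open>q\<close> vanishes on \<open>S\<close>.\<close>
  have "((u - p) + (d - q) - (g - p)) \<bullet> (g - p) = (u + d - g) \<bullet> (g - p) - q \<bullet> (g - p)"
    by (simp add: algebra_simps)
  also have "\<dots> = 0"
    using g(2)[OF gp] p(2)[OF gp] by simp
  finally have "(norm ((g - p) - (d - q)))\<^sup>2 + (norm ((u - p) - (g - p)))\<^sup>2 =
      (norm ((u - p) - (d - q)))\<^sup>2 + 2 * ((u - p) \<bullet> (d - q))"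
    by (rule admm_step_identity)
  moreover have "(g - p) - (d - q) = (g - d) - (p - q)" "(u - p) - (d - q) = (u - d) - (p - q)"
    by simp_all
  ultimately show "(norm ((g - d) - (p - q)))\<^sup>2 + (norm (u - g))\<^sup>2 \<le> (norm ((u - d) - (p - q)))\<^sup>2"
    using mono by simp
  have "(norm ((u - p) - (d - q)))\<^sup>2 =
      (norm (u - p))\<^sup>2 + (norm (d - q))\<^sup>2 - 2 * ((u - p) \<bullet> (d - q))"
    unfolding power2_norm_eq_inner by (simp add: algebra_simps inner_commute)
  then show "(norm (u - p))\<^sup>2 + (norm (d - q))\<^sup>2 \<le> (norm ((u - d) - (p - q)))\<^sup>2"
    using mono \<open>(u - p) - (d - q) = (u - d) - (p - q)\<close> by simp
qed

lemma decseq_nonneg_gap_tendsto_0: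
  fixes V c :: "nat \<Rightarrow> real"
  assumes "\<And>k. 0 \<le> V k" "\<And>k. 0 \<le> c k" "\<And>k. V (Suc k) + c k \<le> V k"
  shows "c \<longlonglongrightarrow> 0"
proof -
  have "decseq V"
    using assms(2,3) by (intro decseq_SucI) (smt (verit))
  then obtain L where L: "V \<longlonglongrightarrow> L"
    using decseq_convergent[of V 0] assms(1) by blast
  have "(\<lambda>k. V k - V (Suc k)) \<longlonglongrightarrow> L - L"
    by (intro tendsto_diff L LIMSEQ_Suc)
  then have "(\<lambda>k. V k - V (Suc k)) \<longlonglongrightarrow> 0"
    by simp
  moreover have "c k \<le> V k - V (Suc k)" for k
    using assms(3)[of k] by simp
  ultimately show ?thesis
    using assms(2) by (intro tendsto_sandwich[of "\<lambda>_. 0" c sequentially]) auto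
qed

lemma admm_converges:
  fixes f :: "'a::euclidean_space \<Rightarrow> real" and u d g :: "nat \<Rightarrow> 'a"
  assumes cont: "continuous_on UNIV f"
    and S: "subspace S"
    and ex: "saddle_point f S p0 q0"
    and g: "\<And>k. g k \<in> S" "\<And>k s. s \<in> S \<Longrightarrow> (u k + d k - g k) \<bullet> s = 0"
    and d: "\<And>k. d (Suc k) = d k - g k + u (Suc k)"
    and sub: "\<And>k v. f (u (Suc k)) - d (Suc k) \<bullet> (v - u (Suc k)) \<le> f v"
  shows "\<exists>p q. saddle_point f S p q \<and> g \<longlonglongrightarrow> p"
proof -
  \<comment> \<open>The index is shifted by one because \<open>u 0\<close> and \<open>d 0\<close>
    are arbitrary: the subgradient inequality starts only at index 1.\<close>
  define V where "V p q k = (norm ((u (Suc k) - d (Suc k)) - (p - q)))\<^sup>2" for p q k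
  have V_step: "V p q (Suc k) + (norm (u (Suc k) - g (Suc k)))\<^sup>2 \<le> V p q k"
    and V_bound: "(norm (u (Suc k) - p))\<^sup>2 + (norm (d (Suc k) - q))\<^sup>2 \<le> V p q k"
    if sp: "saddle_point f S p q" for p q k
  proof -
    \<comment> \<open>By the dual update, the difference of the next pair is \<open>g - d\<close> at
      the current index, so the left side of the descent inequality is the next value of
      \<open>V\<close>.\<close>
    have "u (Suc (Suc k)) - d (Suc (Suc k)) = g (Suc k) - d (Suc k)"
      by (simp add: d)
    then show "V p q (Suc k) + (norm (u (Suc k) - g (Suc k)))\<^sup>2 \<le> V p q k"
      unfolding V_def using admm_descent(1)[OF S sp g sub] by simp
    show "(norm (u (Suc k) - p))\<^sup>2 + (norm (d (Suc k) - q))\<^sup>2 \<le> V p q k"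
      unfolding V_def using admm_descent(2)[OF S sp g sub] by simp
  qed
  have V_dec: "decseq (V p q)" if "saddle_point f S p q" for p q
    using V_step[OF that] by (intro decseq_SucI) (smt (verit) zero_le_power2)
  have "(\<lambda>k. (norm (u (Suc k) - g (Suc k)))\<^sup>2) \<longlonglongrightarrow> 0"
    by (rule decseq_nonneg_gap_tendsto_0[of "V p0 q0"]) (use V_step[OF ex] in \<open>auto simp: V_def\<close>)
  then have gap: "(\<lambda>k. u (Suc k) - g (Suc k)) \<longlonglongrightarrow> 0"
    by (simp add: tendsto_norm_zero_iff)

  have "norm (u (Suc k), d (Suc k)) \<le> sqrt (V p0 q0 0) + norm (p0, q0)" for k
  proof -
    have "norm ((u (Suc k), d (Suc k)) - (p0, q0)) \<le> sqrt (V p0 q0 k)"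
      using V_bound[OF ex] by (simp add: norm_Pair real_sqrt_le_mono)
    also have "\<dots> \<le> sqrt (V p0 q0 0)"
      using V_dec[OF ex] by (simp add: decseq_def)
    finally show ?thesis
      using norm_triangle_ineq2[of "(u (Suc k), d (Suc k))" "(p0, q0)"] by linarith
  qed
  then have "bounded (range (\<lambda>k. (u (Suc k), d (Suc k))))"
    unfolding bounded_iff by blast
  then obtain l r where r: "strict_mono r"
    and "((\<lambda>k. (u (Suc k), d (Suc k))) \<circ> r) \<longlonglongrightarrow> l"
    using bounded_imp_convergent_subsequence by blast
  then obtain p q where "(\<lambda>k. (u (Suc (r k)), d (Suc (r k)))) \<longlonglongrightarrow> (p, q)"
    by (cases l) (auto simp: o_def)
  then have up: "(\<lambda>k. u (Suc (r k))) \<longlonglongrightarrow> p" and dq: "(\<lambda>k. d (Suc (r k))) \<longlonglongrightarrow> q"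
    using tendsto_fst tendsto_snd by fastforce+
  have gap_r: "(\<lambda>k. u (Suc (r k)) - g (Suc (r k))) \<longlonglongrightarrow> 0"
    using LIMSEQ_subseq_LIMSEQ[OF gap r] by (simp add: o_def)
  \<comment> \<open>All three conditions pass to the limit: \<open>g\<close> has the same
    subsequential limit as \<open>u\<close> and \<open>S\<close> is closed; orthogonality to
    \<open>S\<close> loses the term \<open>u - g\<close>; the subgradient inequality follows by
    continuity of \<open>f\<close>.\<close>
  have "saddle_point f S p q"
    unfolding saddle_point_def
  proof (intro conjI ballI allI)
    have "(\<lambda>k. g (Suc (r k))) \<longlonglongrightarrow> p"
      using tendsto_diff[OF up gap_r] by simp
    then show "p \<in> S"
      by (rule closed_sequentially[OF closed_subspace[OF S] g(1)])
  next
    fix s assume s: "s \<in> S"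
    have "(\<lambda>k. (u (Suc (r k)) - g (Suc (r k)) + d (Suc (r k))) \<bullet> s) \<longlonglongrightarrow> (0 + q) \<bullet> s"
      by (intro tendsto_intros gap_r dq)
    moreover have "(u (Suc (r k)) - g (Suc (r k)) + d (Suc (r k))) \<bullet> s = 0" for k
      using g(2)[OF s, of "Suc (r k)"] by (simp add: algebra_simps)
    ultimately show "q \<bullet> s = 0"
      by (simp add: LIMSEQ_const_iff)
  next
    fix v
    have "(\<lambda>k. f (u (Suc (r k)))) \<longlonglongrightarrow> f p"
      using continuous_on_tendsto_compose[OF cont up] by simp
    then have "(\<lambda>k. f (u (Suc (r k))) - d (Suc (r k)) \<bullet> (v - u (Suc (r k)))) \<longlonglongrightarrow> f p - q \<bullet> (v - p)"
      by (intro tendsto_intros up dq)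
    then show "f p - q \<bullet> (v - p) \<le> f v"
      by (rule LIMSEQ_le_const2) (use sub in blast)
  qed
  moreover have "g \<longlonglongrightarrow> p"
  proof -
    note sp = \<open>saddle_point f S p q\<close>
    obtain L where L: "V p q \<longlonglongrightarrow> L"
      using decseq_convergent[OF V_dec[OF sp], of 0] by (auto simp: V_def)
    \<comment> \<open>The monotone sequence \<open>V p q\<close> has a limit, and along the
      subsequence that limit is 0, so the whole sequence tends to 0. This upgrades subsequential to
      full convergence.\<close>
    have "(\<lambda>k. V p q (r k)) \<longlonglongrightarrow> (norm ((p - q) - (p - q)))\<^sup>2"
      unfolding V_def by (intro tendsto_intros up dq)
    then have "L = 0"
      using LIMSEQ_subseq_LIMSEQ[OF L r] by (simp add: o_def LIMSEQ_unique)
    have "(\<lambda>k. (norm (u (Suc k) - p))\<^sup>2) \<longlonglongrightarrow> 0"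
    proof (rule tendsto_sandwich[where f = "\<lambda>_. 0" and h = "V p q"])
      show "V p q \<longlonglongrightarrow> 0" using L \<open>L = 0\<close> by simp
      show "\<forall>\<^sub>F k in sequentially. (norm (u (Suc k) - p))\<^sup>2 \<le> V p q k"
        using V_bound[OF sp] by (intro always_eventually allI) (smt (verit) zero_le_power2)
    qed auto
    then have "(\<lambda>k. u (Suc k) - p) \<longlonglongrightarrow> 0"
      by (simp add: tendsto_norm_zero_iff)
    from tendsto_add[OF tendsto_diff[OF this gap] tendsto_const[of p]]
    show "g \<longlonglongrightarrow> p"
      by (simp add: filterlim_sequentially_Suc)
  qed
  ultimately show ?thesis by blast
qed

section \<open>Linear systems behind the matrix inverses\<close>

lemma matrix_vector_mult_matrix_inv:
  fixes N :: "real ^ 'n::finite ^ 'n"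
  assumes "invertible N"
  shows "N *v (matrix_inv N *v x) = x"
proof -
  have "N ** matrix_inv N = mat 1"
    using someI_ex[OF assms[unfolded invertible_def]] by (simp add: matrix_inv_def)
  then show ?thesis
    by (simp add: matrix_vector_mul_assoc)
qed

text \<open>As a simp rule this would rewrite \<open>transpose N *v x\<close> to
  \<open>x v* N\<close>, hiding the form that the adjoint identity below matches.\<close>

declare transpose_matrix_vector [simp del]

lemma inner_transpose_matrix_vector:
  fixes N :: "real ^ 'n::finite ^ 'm::finite"
  shows "(transpose N *v x) \<bullet> y = x \<bullet> (N *v y)"
  by (metis dot_lmul_matrix vector_transpose_matrix transpose_transpose)

lemma gram_plus_scaled_identity_mult:
  fixes N :: "real ^ 'n::finite ^ 'm::finite"
  shows "(transpose N ** N + c *\<^sub>R mat 1) *v x = transpose N *v (N *v x) + c *\<^sub>R x"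
  by (simp add: matrix_vector_mult_add_rdistrib scaleR_matrix_vector_assoc[symmetric]
      matrix_vector_mul_assoc)

lemma invertible_gram_plus_scaled_identity:
  fixes N :: "real ^ 'n::finite ^ 'm::finite"
  assumes "c > 0"
  shows "invertible (transpose N ** N + c *\<^sub>R mat 1)"
  unfolding invertible_left_inverse matrix_left_invertible_ker
proof (intro allI impI)
  fix x assume "(transpose N ** N + c *\<^sub>R mat 1) *v x = 0"
  \<comment> \<open>Pairing a kernel vector with itself exposes positive definiteness.\<close>
  then have "(transpose N *v (N *v x) + c *\<^sub>R x) \<bullet> x = 0"
    by (simp add: gram_plus_scaled_identity_mult)
  then have "(N *v x) \<bullet> (N *v x) + c * (x \<bullet> x) = 0"
    by (simp add: inner_add_left inner_transpose_matrix_vector)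
  then have "c * (x \<bullet> x) \<le> 0"
    using inner_ge_zero[of "N *v x"] by linarith
  then show "x = 0"
    using assms by (metis inner_gt_zero_iff mult_pos_pos not_less)
qed

section \<open>Soft thresholding and the quadratic misfit\<close>

text \<open>Soft thresholding is the proximal map of \<open>\<gamma> * norm1\<close>: the removed
  part \<open>v - soft v \<gamma>\<close> is a subgradient at the thresholded point. The claim
  separates into coordinates.\<close>

lemma soft_subgradient:
  assumes "\<gamma> \<ge> 0"
  shows "\<gamma> * norm1 (soft v \<gamma>) + (v - soft v \<gamma>) \<bullet> (w - soft v \<gamma>) \<le> \<gamma> * norm1 w"
proof -
  have *: "\<gamma> * \<bar>sgn a * max (\<bar>a\<bar> - \<gamma>) 0\<bar> + (a - sgn a * max (\<bar>a\<bar> - \<gamma>) 0) * (b - sgn a * max (\<bar>a\<bar> - \<gamma>) 0)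
      \<le> \<gamma> * \<bar>b\<bar>" for a b :: real
  \<comment> \<open>Either the threshold gives 0 and
    \<open>a * b \<le> \<gamma> * \<bar>b\<bar>\<close> remains, or the removed part is
    \<open>\<gamma> * sgn a\<close> and the claim reduces to
    \<open>\<gamma> * sgn a * b \<le> \<gamma> * \<bar>b\<bar>\<close>.\<close>
  proof (cases "\<bar>a\<bar> \<le> \<gamma>")
    case True
    have "a * b \<le> \<bar>a\<bar> * \<bar>b\<bar>"
      by (metis abs_ge_self abs_mult)
    also have "\<dots> \<le> \<gamma> * \<bar>b\<bar>"
      using True by (simp add: mult_right_mono)
    finally show ?thesis
      using True by simp
  next
    case False
    have "\<gamma> * b \<le> \<gamma> * \<bar>b\<bar>" "\<gamma> * - b \<le> \<gamma> * \<bar>b\<bar>"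
      using assms by (intro mult_left_mono; simp)+
    then show ?thesis
      using False assms by (cases "a > 0") (auto simp: sgn_if max_def abs_if algebra_simps)
  qed
  have "\<gamma> * norm1 (soft v \<gamma>) + (v - soft v \<gamma>) \<bullet> (w - soft v \<gamma>) =
      (\<Sum>i\<in>UNIV. \<gamma> * \<bar>soft v \<gamma> $ i\<bar> + (v $ i - soft v \<gamma> $ i) * (w $ i - soft v \<gamma> $ i))"
    by (simp add: norm1_def inner_vec_def sum.distrib sum_distrib_left)
  also have "\<dots> \<le> (\<Sum>i\<in>UNIV. \<gamma> * \<bar>w $ i\<bar>)"
    by (intro sum_mono) (simp only: soft_def vec_lambda_beta *)
  also have "\<dots> = \<gamma> * norm1 w"
    by (simp add: norm1_def sum_distrib_left)
  finally show ?thesis .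
qed

text \<open>The exact Taylor expansion at \<open>u\<close>. Dropping the square gives the gradient
  inequality; keeping it controls small steps along a segment.\<close>

lemma quadratic_misfit_expansion:
  fixes N :: "real ^ 'n::finite ^ 'm::finite"
  shows "1 / 2 * (norm (y - N *v v))\<^sup>2 = 1 / 2 * (norm (y - N *v u))\<^sup>2
    - (transpose N *v (y - N *v u)) \<bullet> (v - u) + 1 / 2 * (norm (N *v (v - u)))\<^sup>2"
  unfolding inner_transpose_matrix_vector power2_norm_eq_inner
  by (simp add: algebra_simps inner_commute)

lemma continuous_on_norm1: "continuous_on X norm1"
  unfolding norm1_def by (intro continuous_intros)

section \<open>Existence of a minimiser and its optimality condition\<close>

lemma synthesis_objective_minimum_exists:
  assumes "reg > 0"
  shows "\<exists>z0. \<forall>z. synthesis_objective A M W y reg z0 \<le> synthesis_objective A M W y reg z"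
proof -
  let ?F = "synthesis_objective A M W y reg"
  \<comment> \<open>Outside the ball of this radius, \<open>reg * norm z\<close> alone exceeds the
    value at 0, so a minimum over the compact ball is global.\<close>
  define R where "R = ?F 0 / reg"
  have "0 \<le> ?F 0"
    using assms by (simp add: synthesis_objective_def norm1_def)
  then have R: "0 \<le> R"
    using assms by (simp add: R_def)
  have "continuous_on (cball 0 R) ?F"
    unfolding synthesis_objective_def
    by (intro continuous_intros continuous_on_norm1 matrix_vector_mult_linear_continuous_on)
  then obtain z0 where z0: "z0 \<in> cball 0 R" "\<And>z. z \<in> cball 0 R \<Longrightarrow> ?F z0 \<le> ?F z"
    using continuous_attains_inf[of "cball 0 R" ?F] R by auto
  have "?F z0 \<le> ?F z" for z
  proof (cases "z \<in> cball 0 R")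
    case False
    have "?F z0 \<le> ?F 0"
      using z0 R by simp
    also have "\<dots> \<le> reg * norm z"
      using False assms by (simp add: R_def field_simps)
    also have "\<dots> \<le> reg * norm1 z"
      using assms norm_le_l1_cart[of z] by (simp add: norm1_def)
    also have "\<dots> \<le> ?F z"
      by (simp add: synthesis_objective_def)
    finally show ?thesis .
  qed (use z0 in blast)
  then show ?thesis by blast
qed

lemma norm1_segment_le:
  assumes "0 \<le> t" "t \<le> 1"
  shows "norm1 (a + t *\<^sub>R (b - a)) \<le> norm1 a + t * (norm1 b - norm1 a)"
proof -
  have "\<bar>a $ i + t * (b $ i - a $ i)\<bar> \<le> \<bar>a $ i\<bar> + t * (\<bar>b $ i\<bar> - \<bar>a $ i\<bar>)" for i
  proof -
    have "\<bar>(1 - t) * a $ i + t * b $ i\<bar> \<le> (1 - t) * \<bar>a $ i\<bar> + t * \<bar>b $ i\<bar>"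
      using assms abs_triangle_ineq[of "(1 - t) * a $ i" "t * b $ i"] by (simp add: abs_mult)
    then show ?thesis
      by (simp add: algebra_simps)
  qed
  then have "norm1 (a + t *\<^sub>R (b - a)) \<le> (\<Sum>i\<in>UNIV. \<bar>a $ i\<bar> + t * (\<bar>b $ i\<bar> - \<bar>a $ i\<bar>))"
    unfolding norm1_def by (intro sum_mono) simp
  then show ?thesis
    by (simp add: norm1_def sum.distrib sum_subtractf flip: sum_distrib_left)
qed

text \<open>Fermat's rule for a smooth plus a convex term: the negative gradient of the misfit at
  the minimiser is a subgradient of \<open>reg * norm1\<close>.\<close>

lemma l1_least_squares_optimality:
  fixes N :: "real ^ 'n::finite ^ 'm::finite"
  assumes min: "\<And>z. 1 / 2 * (norm (y - N *v z0))\<^sup>2 + reg * norm1 z0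
      \<le> 1 / 2 * (norm (y - N *v z))\<^sup>2 + reg * norm1 z"
    and "reg \<ge> 0"
  shows "reg * norm1 z0 + (transpose N *v (y - N *v z0)) \<bullet> (z - z0) \<le> reg * norm1 z"
proof -
  define b where "b = (transpose N *v (y - N *v z0)) \<bullet> (z - z0)"
  define c where "c = 1 / 2 * (norm (N *v (z - z0)))\<^sup>2"
  \<comment> \<open>Minimality is tested at a fraction \<open>t\<close> of the way from
    \<open>z0\<close> to \<open>z\<close>. Dividing by \<open>t\<close> leaves the quadratic
    remainder \<open>t * c\<close>, which vanishes as \<open>t\<close> decreases to 0.\<close>
  have "reg * norm1 z0 + b \<le> reg * norm1 z + t * c" if t: "0 < t" "t \<le> 1" for t
  proof -
    define zt where "zt = z0 + t *\<^sub>R (z - z0)"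
    have zt: "zt - z0 = t *\<^sub>R (z - z0)"
      by (simp add: zt_def)
    have "1 / 2 * (norm (y - N *v zt))\<^sup>2 = 1 / 2 * (norm (y - N *v z0))\<^sup>2 - t * b + t\<^sup>2 * c"
      unfolding quadratic_misfit_expansion[of y N zt z0] zt b_def c_def
      by (simp add: matrix_vector_mult_scaleR power_mult_distrib)
    moreover have "reg * norm1 zt \<le> reg * (norm1 z0 + t * (norm1 z - norm1 z0))"
      unfolding zt_def using t \<open>reg \<ge> 0\<close> by (intro mult_left_mono norm1_segment_le) auto
    ultimately have "0 \<le> t * (t * c - b + reg * (norm1 z - norm1 z0))"
      using min[of zt] by (simp add: algebra_simps power2_eq_square)
    then have "0 \<le> t * c - b + reg * (norm1 z - norm1 z0)"
      using t by (simp only: zero_le_mult_iff) linarith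
    then show ?thesis
      by (simp add: algebra_simps)
  qed
  then have "\<forall>\<^sub>F t in at_right 0. reg * norm1 z0 + b \<le> reg * norm1 z + t * c"
    by (intro eventually_at_rightI[of 0 1]) auto
  moreover have "((\<lambda>t. reg * norm1 z + t * c) \<longlongrightarrow> reg * norm1 z + 0 * c) (at_right 0)"
    by (intro tendsto_intros)
  ultimately show ?thesis
    unfolding b_def by (intro tendsto_lowerbound) auto
qed

section \<open>FS-MD as an instance of ADMM\<close>

lemma FS_MD_converges:
  fixes A :: "real ^ 'n::finite ^ 'n"
    and M :: "real ^ 'n ^ 'm::finite"
    and W :: "real ^ 'd::finite ^ 'n"
  assumes reg: "reg > 0" and mu: "\<mu>1 > 0" "\<mu>2 > 0"
    and run: "FS_MD A M W y reg \<mu>1 \<mu>2 z u1 d1 u2 d2"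
  shows "\<exists>zstar. z \<longlonglongrightarrow> zstar \<and>
           is_arg_min (synthesis_objective A M W y reg) (\<lambda>_. True) zstar"
proof -
  define B where "B = A ** W"
  \<comment> \<open>With square-root scaling, inner products of scaled pairs carry exactly the
    weights \<open>\<mu>1\<close> and \<open>\<mu>2\<close>. The function \<open>f\<close> below
    undoes the scaling, so that \<open>f (G v)\<close> is the objective.\<close>
  define a b where "a = sqrt \<mu>1" and "b = sqrt \<mu>2"
  have ab: "a > 0" "b > 0" "a * a = \<mu>1" "b * b = \<mu>2"
    using mu by (auto simp: a_def b_def)
  have obj: "synthesis_objective A M W y reg v =
      1 / 2 * (norm (y - M *v (B *v v)))\<^sup>2 + reg * norm1 v" for v
    by (simp add: synthesis_objective_def B_def matrix_mul_assoc matrix_vector_mul_assoc)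
  define G where "G v = (a *\<^sub>R (B *v v), b *\<^sub>R v)" for v
  define f :: "(real ^ 'n) \<times> (real ^ 'd) \<Rightarrow> real"
    where "f = (\<lambda>(p, q). 1 / 2 * (norm (y - M *v ((1 / a) *\<^sub>R p)))\<^sup>2 + reg * norm1 ((1 / b) *\<^sub>R q))"
  define S where "S = range G"
  define u where "u k = (a *\<^sub>R u1 k, b *\<^sub>R u2 k)" for k
  define d where "d k = (a *\<^sub>R d1 k, b *\<^sub>R d2 k)" for k
  have f: "f (a *\<^sub>R p, b *\<^sub>R q) = 1 / 2 * (norm (y - M *v p))\<^sup>2 + reg * norm1 q" for p q
    using ab by (simp add: f_def)
  have fG: "f (G v) = synthesis_objective A M W y reg v" for v
    by (simp add: G_def f obj)
  have scaled: "\<exists>p q. v = (a *\<^sub>R p, b *\<^sub>R q)" for v :: "(real ^ 'n) \<times> (real ^ 'd)"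
    using ab by (intro exI[of _ "(1 / a) *\<^sub>R fst v"] exI[of _ "(1 / b) *\<^sub>R snd v"]) simp
  have misfit: "1 / 2 * (norm (y - M *v p))\<^sup>2 - (transpose M *v (y - M *v p)) \<bullet> (v - p)
      \<le> 1 / 2 * (norm (y - M *v v))\<^sup>2" for p v
    unfolding quadratic_misfit_expansion[of y M v p] by simp

  have z: "(transpose B ** B + (\<mu>2 / \<mu>1) *\<^sub>R mat 1) *v z (Suc k) =
        transpose B *v (u1 k + d1 k) + (\<mu>2 / \<mu>1) *\<^sub>R (u2 k + d2 k)"
    and u1: "(transpose M ** M + \<mu>1 *\<^sub>R mat 1) *v u1 (Suc k) =
        transpose M *v y + \<mu>1 *\<^sub>R (B *v z (Suc k) - d1 k)"
    and d1: "d1 (Suc k) = d1 k - (B *v z (Suc k) - u1 (Suc k))"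
    and u2: "u2 (Suc k) = soft (z (Suc k) - d2 k) (reg / \<mu>2)"
    and d2: "d2 (Suc k) = d2 k - (z (Suc k) - u2 (Suc k))" for k
  proof -
    have "transpose W ** transpose A ** A ** W = transpose B ** B"
      "transpose W ** transpose A = transpose B"
      by (simp_all add: B_def matrix_transpose_mul matrix_mul_assoc)
    with run have "z (Suc k) = matrix_inv (transpose B ** B + (\<mu>2 / \<mu>1) *\<^sub>R mat 1) *v
        (transpose B *v (u1 k + d1 k) + (\<mu>2 / \<mu>1) *\<^sub>R (u2 k + d2 k))"
      by (simp add: FS_MD_def)
    then show "(transpose B ** B + (\<mu>2 / \<mu>1) *\<^sub>R mat 1) *v z (Suc k) =
        transpose B *v (u1 k + d1 k) + (\<mu>2 / \<mu>1) *\<^sub>R (u2 k + d2 k)"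
      using mu by (simp only: matrix_vector_mult_matrix_inv
          invertible_gram_plus_scaled_identity divide_pos_pos)
    have "u1 (Suc k) = matrix_inv (transpose M ** M + \<mu>1 *\<^sub>R mat 1) *v
        (transpose M *v y + \<mu>1 *\<^sub>R (B *v z (Suc k) - d1 k))"
      using run unfolding FS_MD_def B_def by blast
    then show "(transpose M ** M + \<mu>1 *\<^sub>R mat 1) *v u1 (Suc k) =
        transpose M *v y + \<mu>1 *\<^sub>R (B *v z (Suc k) - d1 k)"
      using mu by (simp only: matrix_vector_mult_matrix_inv invertible_gram_plus_scaled_identity)
  qed (use run in \<open>unfold FS_MD_def B_def, blast+\<close>)

  have linG: "linear G"
    unfolding G_def
    by (intro linearI) (simp_all add: matrix_vector_right_distrib matrix_vector_mult_scaleR scaleR_add_right)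

  obtain z0 where z0: "\<And>v. synthesis_objective A M W y reg z0 \<le> synthesis_objective A M W y reg v"
    using synthesis_objective_minimum_exists[OF reg] by blast
  \<comment> \<open>This is the negative gradient of the misfit at \<open>B *v z0\<close>. Its image
    under \<open>transpose B\<close> is the subgradient of the l1 term supplied by
    optimality.\<close>
  define q0 where "q0 = transpose M *v (y - M *v (B *v z0))"
  have opt: "reg * norm1 z0 + (transpose B *v q0) \<bullet> (v - z0) \<le> reg * norm1 v" for v
    using l1_least_squares_optimality[of y "M ** B" z0 reg v] z0 reg
    by (simp add: obj q0_def matrix_vector_mul_assoc matrix_transpose_mul)

  have "\<exists>p q. saddle_point f S p q \<and> (\<lambda>k. G (z (Suc k))) \<longlonglongrightarrow> p"
  proof (rule admm_converges)
    show "continuous_on UNIV f"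
      unfolding f_def case_prod_beta
      by (intro continuous_intros continuous_on_compose2[OF continuous_on_norm1[of UNIV]]
          continuous_on_compose2[OF matrix_vector_mult_linear_continuous_on[of UNIV M]]) auto
    show "subspace S"
      unfolding S_def using linG by (simp add: linear_subspace_image)
    \<comment> \<open>The first component of the multiplier comes from the misfit gradient, divided
      by \<open>a\<close> for the scaling. The second is what orthogonality to the range of
      \<open>G\<close> forces, and \<open>opt\<close> makes its negative a subgradient of the l1
      part.\<close>
    show "saddle_point f S (G z0) ((1 / a) *\<^sub>R q0, - (1 / b) *\<^sub>R (transpose B *v q0))"
      unfolding saddle_point_def
    proof (intro conjI ballI allI)
      fix s assume "s \<in> S"
      then obtain v where "s = G v"
        by (auto simp: S_def)
      then show "((1 / a) *\<^sub>R q0, - (1 / b) *\<^sub>R (transpose B *v q0)) \<bullet> s = 0"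
        using ab by (simp add: G_def inner_Pair inner_transpose_matrix_vector)
    next
      fix v :: "(real ^ 'n) \<times> (real ^ 'd)"
      obtain p q where v: "v = (a *\<^sub>R p, b *\<^sub>R q)"
        using scaled by blast
      have "((1 / a) *\<^sub>R q0, - (1 / b) *\<^sub>R (transpose B *v q0)) \<bullet> (v - G z0) =
          q0 \<bullet> (p - B *v z0) - (transpose B *v q0) \<bullet> (q - z0)"
        unfolding v G_def using ab by (simp add: inner_Pair flip: scaleR_diff_right)
      then show "f (G z0) - ((1 / a) *\<^sub>R q0, - (1 / b) *\<^sub>R (transpose B *v q0)) \<bullet> (v - G z0) \<le> f v"
        unfolding fG obj v f using misfit[of "B *v z0" p] opt[of q] by (simp add: q0_def)
    qed (simp add: S_def)
    show "G (z (Suc k)) \<in> S" for k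
      by (simp add: S_def)
    show "(u k + d k - G (z (Suc k))) \<bullet> s = 0" if "s \<in> S" for k s
    proof -
      obtain v where v: "s = G v"
        using \<open>s \<in> S\<close> by (auto simp: S_def)
      \<comment> \<open>The linear system for \<open>z (Suc k)\<close>, multiplied by
        \<open>\<mu>1\<close>, is the normal equation of the projection onto the range of
        \<open>G\<close>.\<close>
      have "\<mu>1 *\<^sub>R (transpose B *v (u1 k + d1 k - B *v z (Suc k))) +
          \<mu>2 *\<^sub>R (u2 k + d2 k - z (Suc k)) = \<mu>1 *\<^sub>R
          (transpose B *v (u1 k + d1 k) + (\<mu>2 / \<mu>1) *\<^sub>R (u2 k + d2 k)
           - (transpose B ** B + (\<mu>2 / \<mu>1) *\<^sub>R mat 1) *v z (Suc k))"
        unfolding gram_plus_scaled_identity_mult using mu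
        by (simp add: matrix_vector_right_distrib matrix_vector_mult_diff_distrib algebra_simps)
      also have "\<dots> = 0"
        by (simp add: z)
      finally have "(\<mu>1 *\<^sub>R (transpose B *v (u1 k + d1 k - B *v z (Suc k))) +
          \<mu>2 *\<^sub>R (u2 k + d2 k - z (Suc k))) \<bullet> v = 0"
        by simp
      moreover have "u k + d k - G (z (Suc k)) =
          (a *\<^sub>R (u1 k + d1 k - B *v z (Suc k)), b *\<^sub>R (u2 k + d2 k - z (Suc k)))"
        by (simp add: u_def d_def G_def algebra_simps)
      ultimately show ?thesis
        unfolding v G_def
        by (simp add: inner_Pair inner_add_left[of "\<mu>1 *\<^sub>R _"] inner_transpose_matrix_vector ab
            flip: mult.assoc)
    qed
    show "d (Suc k) = d k - G (z (Suc k)) + u (Suc k)" for k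
      by (simp add: u_def d_def G_def d1[of k] d2[of k] algebra_simps)
    show "f (u (Suc k)) - d (Suc k) \<bullet> (v - u (Suc k)) \<le> f v" for k v
    proof -
      obtain p q where v: "v = (a *\<^sub>R p, b *\<^sub>R q)"
        using scaled by blast
      \<comment> \<open>The linear system for \<open>u1 (Suc k)\<close> combined with the update of
        \<open>d1\<close>: the new dual variable is the misfit gradient up to the factor
        \<open>- \<mu>1\<close>.\<close>
      have grad: "transpose M *v (y - M *v u1 (Suc k)) = \<mu>1 *\<^sub>R d1 (Suc k)"
        using u1[of k] unfolding gram_plus_scaled_identity_mult d1[of k]
        by (simp add: matrix_vector_mult_diff_distrib algebra_simps)
      \<comment> \<open>The part removed by the threshold is \<open>- d2 (Suc k)\<close>.
        Multiplication by \<open>\<mu>2\<close> then restores the weight \<open>reg\<close>.\<close>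
      have "reg / \<mu>2 * norm1 (u2 (Suc k)) - d2 (Suc k) \<bullet> (q - u2 (Suc k)) \<le> reg / \<mu>2 * norm1 q"
        using soft_subgradient[of "reg / \<mu>2" "z (Suc k) - d2 k" q] reg mu
        unfolding u2[of k, symmetric] d2[of k] by (simp add: algebra_simps)
      then have "\<mu>2 * (reg / \<mu>2 * norm1 (u2 (Suc k)) - d2 (Suc k) \<bullet> (q - u2 (Suc k)))
          \<le> \<mu>2 * (reg / \<mu>2 * norm1 q)"
        using mu by (intro mult_left_mono) auto
      then have "reg * norm1 (u2 (Suc k)) - \<mu>2 * (d2 (Suc k) \<bullet> (q - u2 (Suc k))) \<le> reg * norm1 q"
        using mu by (simp add: right_diff_distrib)
      moreover have "1 / 2 * (norm (y - M *v u1 (Suc k)))\<^sup>2 - \<mu>1 * (d1 (Suc k) \<bullet> (p - u1 (Suc k)))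
          \<le> 1 / 2 * (norm (y - M *v p))\<^sup>2"
        using misfit[of "u1 (Suc k)" p] unfolding grad by simp
      moreover have "d (Suc k) \<bullet> (v - u (Suc k)) =
          \<mu>1 * (d1 (Suc k) \<bullet> (p - u1 (Suc k))) + \<mu>2 * (d2 (Suc k) \<bullet> (q - u2 (Suc k)))"
        unfolding v u_def d_def
        by (simp add: inner_Pair ab flip: scaleR_diff_right mult.assoc)
      ultimately show ?thesis
        unfolding v f u_def by linarith
    qed
  qed
  then obtain p q where pq: "saddle_point f S p q" "(\<lambda>k. G (z (Suc k))) \<longlonglongrightarrow> p"
    by blast
  then obtain zstar where zstar: "p = G zstar"
    by (auto simp: saddle_point_def S_def)
  have "synthesis_objective A M W y reg zstar \<le> synthesis_objective A M W y reg v" for v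
    using saddle_point_minimum[OF _ pq(1), of "G v"] linG
    by (simp add: S_def linear_subspace_image zstar fG)
  moreover have "z \<longlonglongrightarrow> zstar"
  proof -
    \<comment> \<open>The second component of \<open>G\<close> is a multiple of the identity, so it
      returns \<open>z\<close> itself. The dummy value \<open>z 0\<close> does not affect the
      limit.\<close>
    have "(\<lambda>k. (1 / b) *\<^sub>R snd (G (z (Suc k)))) \<longlonglongrightarrow> (1 / b) *\<^sub>R snd p"
      by (intro tendsto_intros pq(2))
    then show ?thesis
      using ab by (simp add: G_def zstar filterlim_sequentially_Suc)
  qed
  ultimately show ?thesis
    by (auto simp: is_arg_min_def not_less)
qed

theorem proposition5:
  fixes A :: "(real ^ ('r::finite, 'c::finite) pixel) ^ ('r, 'c) pixel"
    and M :: "(real ^ ('r, 'c) pixel) ^ 'm::finite"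
    and W :: "(real ^ 'd::finite) ^ ('r, 'c) pixel"
    and y :: "real ^ 'm"
    and reg \<mu>1 \<mu>2 :: real
    and z u2 d2 :: "nat \<Rightarrow> real ^ 'd"
    and u1 d1 :: "nat \<Rightarrow> real ^ ('r, 'c) pixel"
  assumes "CARD('m) < CARD(('r, 'c) pixel)"
    and "CARD('d) \<ge> CARD(('r, 'c) pixel)"
    and "reg > 0"
    and "periodic_convolution A"
    and "masking_matrix M"
    and "is_frame (\<lambda>j. column j W)"
    and "\<mu>1 > 0" and "\<mu>2 > 0"
    and "FS_MD A M W y reg \<mu>1 \<mu>2 z u1 d1 u2 d2"
  shows "\<exists>zstar. z \<longlonglongrightarrow> zstar \<and>
           is_arg_min (synthesis_objective A M W y reg) (\<lambda>_. True) zstar"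
  using assms(3,7,8,9) by (rule FS_MD_converges)

end
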